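(* Let $a,b,c,d,e,f$ be nonnegative real numbers, and put $$A=cd(b+e)(a+f)+be(c+d)(a+f)+af(c+d)(b+e),$$ $$C=cd(a+b+e+f)+af(b+c+d+e)+be(a+c+d+f)+abd+ace+bcf+def.$$ Assume $C\neq 0$. Then $$\frac{15}{32}(a+b+c+d+e+f)-\frac{7(abef+acdf+bcde)+2A}{C}\ \ge\ 0,$$ and equality holds if $a=b=c=d=e=f>0$. *)

theory Defs
  imports Complex_Main
begin

end

theory Submission
  imports Defs
begin

text \<open>
  After clearing the positive denominator \<open>C\<close>, the claim is that a quartic form is nonnegative on
  the orthant. The six variables are the edges of a complete graph on four vertices, opposite
  edges being \<open>a, f\<close> and \<open>b, e\<close> and \<open>c, d\<close>, and \<open>C\<close> is the sum over its spanning trees. Each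
  opposite pair is described by its mean and its relative deviation:
  \<open>a = p(1 + x)\<close>, \<open>f = p(1 - x)\<close>, and likewise \<open>b, e\<close> by \<open>q, y\<close> and \<open>c, d\<close> by \<open>r, z\<close>, with
  \<open>x, y, z\<close> in \<open>[-1, 1]\<close>.

  In these coordinates the form is a polynomial of degree at most one in each of
  \<open>x\<^sup>2, y\<^sup>2, z\<^sup>2\<close>, except for the single term \<open>-120 (p + q + r) p q r x y z\<close>. That term is
  bounded by \<open>6 x y z \<le> x\<^sup>2 + y\<^sup>2 + z\<^sup>2 + x\<^sup>2 y\<^sup>2 + y\<^sup>2 z\<^sup>2 + z\<^sup>2 x\<^sup>2\<close>. This has to lose
  nothing where the form vanishes with \<open>p, q, r\<close> positive, and indeed equality holds both at
  \<open>x = y = z = 0\<close>, which contains the equality case, and at \<open>x = y = z = 1\<close>, where only the triangle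
  \<open>a, b, c\<close> has nonzero edges, so that \<open>C = 0\<close> and the whole form is \<open>0\<close>. What remains is affine in
  each of \<open>x\<^sup>2, y\<^sup>2, z\<^sup>2\<close>, hence a convex combination of its values at the vertices of the cube
  \<open>[0, 1]\<^sup>3\<close>. Up to permuting the three pairs there are four vertices: at \<open>(1, 1, 1)\<close> the value
  is \<open>0\<close>, and the other three give inequalities in \<open>p, q, r\<close> alone, namely
  \<open>vertex_000\<close>, \<open>vertex_100\<close> and \<open>vertex_110\<close>. Only the first of these becomes an equality for
  positive \<open>p, q, r\<close>, at \<open>p = q = r\<close>; it follows from Schur's inequality.
\<close>

lemma schur_ineq_ordered:
  fixes p q r :: real
  assumes "p \<ge> q" "q \<ge> r" "r \<ge> 0"
  shows "p*(p-q)*(p-r) + q*(q-p)*(q-r) + r*(r-p)*(r-q) \<ge> 0"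
proof -
  have "p*(p-q)*(p-r) + q*(q-p)*(q-r) + r*(r-p)*(r-q)
      = (p-q)*((p-q)*(p+q-r)) + r*((p-r)*(q-r))"
    by algebra
  also have "\<dots> \<ge> 0"
    using assms by (intro add_nonneg_nonneg mult_nonneg_nonneg) auto
  finally show ?thesis .
qed

lemma schur_ineq:
  fixes p q r :: real
  assumes "p \<ge> 0" "q \<ge> 0" "r \<ge> 0"
  shows "p*(p-q)*(p-r) + q*(q-p)*(q-r) + r*(r-p)*(r-q) \<ge> 0"
  using schur_ineq_ordered[of p q r] schur_ineq_ordered[of p r q] schur_ineq_ordered[of q p r]
    schur_ineq_ordered[of q r p] schur_ineq_ordered[of r p q] schur_ineq_ordered[of r q p] assms
  by (smt (verit) mult.commute mult.assoc)

text \<open>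
  In terms of \<open>E = (p + q + r)\<^sup>2\<close> and \<open>F = p q + q r + r p\<close>, Schur's inequality reads
  \<open>9 (p + q + r) p q r \<ge> 4 E F - E\<^sup>2\<close>, and inserting it leaves a multiple of
  \<open>(E - 3 F) (56 F - 11 E)\<close>. The first factor is nonnegative; when the second is negative, \<open>E\<close> is
  so large that the term \<open>60 E F\<close> alone suffices.
\<close>
lemma vertex_000:
  fixes p q r :: real
  assumes "p \<ge> 0" "q \<ge> 0" "r \<ge> 0"
  shows "60*(p+q+r)^2*(p*q+q*r+r*p) + 132*(p+q+r)*(p*q*r) - 224*(p*q+q*r+r*p)^2 \<ge> 0"
proof -
  define E where "E = (p+q+r)^2"
  define F where "F = p*q+q*r+r*p"
  define T where "T = (p+q+r)*(p*q*r)"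
  have F0: "F \<ge> 0" and T0: "T \<ge> 0"
    using assms by (auto simp: F_def T_def)
  have "2*(E - 3*F) = (p-q)^2 + (q-r)^2 + (r-p)^2"
    unfolding E_def F_def by algebra
  then have EF: "E - 3*F \<ge> 0"
    by (smt (verit) zero_le_power2)
  have "9*T - (4*E*F - E^2)
      = (p+q+r) * (p*(p-q)*(p-r) + q*(q-p)*(q-r) + r*(r-p)*(r-q))"
    unfolding E_def F_def T_def by algebra
  also have "\<dots> \<ge> 0"
    using assms schur_ineq[of p q r] by (intro mult_nonneg_nonneg) auto
  finally have S: "9*T - (4*E*F - E^2) \<ge> 0" .
  have "60*E*F + 132*T - 224*F^2 \<ge> 0"
  proof (cases "11*E \<le> 56*F")
    case True
    have "60*E*F + 132*T - 224*F^2
        = 44/3 * (9*T - (4*E*F - E^2)) + 4/3 * ((E - 3*F) * (56*F - 11*E))"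
      by (simp add: power2_eq_square field_simps)
    also have "\<dots> \<ge> 0"
      using True S EF by (intro add_nonneg_nonneg mult_nonneg_nonneg) auto
    finally show ?thesis .
  next
    case False
    have "60*E*F + 132*T - 224*F^2 = 4*F*(15*E - 56*F) + 132*T"
      by (simp add: power2_eq_square algebra_simps)
    also have "\<dots> \<ge> 0"
      using False F0 T0 by (intro add_nonneg_nonneg mult_nonneg_nonneg) auto
    finally show ?thesis .
  qed
  then show ?thesis
    unfolding E_def F_def T_def by (simp only: mult.assoc)
qed

lemma vertex_100:
  fixes p q r :: real
  assumes "p \<ge> 0" "q \<ge> 0" "r \<ge> 0"
  shows "60*(p+q+r)*(p*(q^2+r^2) + q*r*(q+r)) + 100*(p+q+r)*(p*q*r)
    - 256*(p*q*r)*(q+r) - 224*(q*r)^2 \<ge> 0"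
proof -
  have "60*(p+q+r)*(p*(q^2+r^2) + q*r*(q+r)) + 100*(p+q+r)*(p*q*r)
        - 256*(p*q*r)*(q+r) - 224*(q*r)^2
      = (60*(p*(p+q+r)) + 56*(q*r)) * (q-r)^2
        + q*r*(220*p^2 + 24*p*(q+r) + 4*(q+r)^2)"
    by algebra
  also have "\<dots> \<ge> 0"
    using assms by (intro add_nonneg_nonneg mult_nonneg_nonneg) auto
  finally show ?thesis .
qed

lemma vertex_110:
  fixes p q r :: real
  assumes "p \<ge> 0" "q \<ge> 0" "r \<ge> 0"
  shows "60*(p+q+r)*(r^2*(p+q) + p*q*r) - 256*(p*q*r^2) \<ge> 0"
proof -
  have "60*(p+q+r)*(r^2*(p+q) + p*q*r) - 256*(p*q*r^2)
      = 60*r*(r*(p-q)^2 + (p+q)*(p*q + r^2)) + 44*(p*q*r^2)"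
    by algebra
  also have "\<dots> \<ge> 0"
    using assms by (intro add_nonneg_nonneg mult_nonneg_nonneg) auto
  finally show ?thesis .
qed

lemma six_prod_le:
  fixes x y z :: real
  shows "6*(x*y*z) \<le> x^2 + y^2 + z^2 + x^2*y^2 + y^2*z^2 + z^2*x^2"
proof -
  have "x^2 + y^2 + z^2 + x^2*y^2 + y^2*z^2 + z^2*x^2 - 6*(x*y*z)
      = (x - y*z)^2 + (y - z*x)^2 + (z - x*y)^2"
    by algebra
  then show ?thesis
    by (smt (verit) zero_le_power2)
qed

text \<open>
  The right-hand side of the identity in the proof is multilinear interpolation from the vertices of
  the cube, plus \<open>20 (p + q + r) p q r\<close> times the gap in \<open>six_prod_le\<close>. The vertex \<open>(1, 1, 1)\<close> contributes no
  summand, its value being \<open>0\<close>.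
\<close>
lemma quartic_nonneg_mean_deviation:
  fixes p q r x y z :: real
  assumes pqr: "p \<ge> 0" "q \<ge> 0" "r \<ge> 0" and xyz: "x^2 \<le> 1" "y^2 \<le> 1" "z^2 \<le> 1"
    and abc: "a = p*(1+x)" "f = p*(1-x)" "b = q*(1+y)" "e = q*(1-y)" "c = r*(1+z)" "d = r*(1-z)"
  shows "15*(a+b+c+d+e+f)*(c*d*(a+b+e+f) + a*f*(b+c+d+e) + b*e*(a+c+d+f)
                + a*b*d + a*c*e + b*c*f + d*e*f)
    - 32*(7*(a*b*e*f + a*c*d*f + b*c*d*e)
      + 2*(c*d*(b+e)*(a+f) + b*e*(c+d)*(a+f) + a*f*(c+d)*(b+e))) \<ge> 0" (is "?P \<ge> 0")
proof -
  define V0 where "V0 = 60*(p+q+r)^2*(p*q+q*r+r*p) + 132*(p+q+r)*(p*q*r) - 224*(p*q+q*r+r*p)^2"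
  define V1 where "V1 = (\<lambda>p q r::real. 60*(p+q+r)*(p*(q^2+r^2) + q*r*(q+r))
    + 100*(p+q+r)*(p*q*r) - 256*(p*q*r)*(q+r) - 224*(q*r)^2)"
  define V2 where "V2 = (\<lambda>p q r::real. 60*(p+q+r)*(r^2*(p+q) + p*q*r) - 256*(p*q*r^2))"
  have V: "V0 \<ge> 0" "V1 p q r \<ge> 0" "V1 q r p \<ge> 0" "V1 r p q \<ge> 0"
    "V2 p q r \<ge> 0" "V2 q r p \<ge> 0" "V2 r p q \<ge> 0"
    unfolding V0_def V1_def V2_def using pqr
    by (auto intro!: vertex_000 vertex_100 vertex_110 simp only:)
  have "?P = (1-x^2)*(1-y^2)*(1-z^2)*V0
      + x^2*(1-y^2)*(1-z^2)*V1 p q r + y^2*(1-z^2)*(1-x^2)*V1 q r p + z^2*(1-x^2)*(1-y^2)*V1 r p q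
      + x^2*y^2*(1-z^2)*V2 p q r + y^2*z^2*(1-x^2)*V2 q r p + z^2*x^2*(1-y^2)*V2 r p q
      + 20*(p+q+r)*(p*q*r)
        * (x^2 + y^2 + z^2 + x^2*y^2 + y^2*z^2 + z^2*x^2 - 6*(x*y*z))"
    unfolding abc V0_def V1_def V2_def by algebra
  also have "\<dots> \<ge> 0"
    using V pqr xyz six_prod_le[of x y z]
    by (intro add_nonneg_nonneg mult_nonneg_nonneg) auto
  finally show ?thesis .
qed

lemma mean_deviation:
  fixes s t :: real
  assumes "s \<ge> 0" "t \<ge> 0"
  obtains p x where "p \<ge> 0" "x^2 \<le> 1" "s = p*(1+x)" "t = p*(1-x)"
proof (cases "s + t = 0")
  case True
  then show ?thesis using assms that[of 0 0] by auto
next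
  case False
  then have pos: "s + t > 0" using assms by auto
  have "\<bar>(s-t)/(s+t)\<bar> \<le> 1"
    using assms pos by (auto simp: abs_le_iff field_simps)
  then have "((s-t)/(s+t))^2 \<le> 1"
    by (simp add: abs_square_le_1)
  moreover have "s = (s+t)/2*(1 + (s-t)/(s+t))" "t = (s+t)/2*(1 - (s-t)/(s+t))"
    using pos by (simp_all add: field_simps)
  ultimately show ?thesis
    using that[of "(s+t)/2" "(s-t)/(s+t)"] pos by auto
qed

theorem mainTheorem3:
  fixes a b c d e f A C :: real
  assumes nonneg: "a \<ge> 0" "b \<ge> 0" "c \<ge> 0" "d \<ge> 0" "e \<ge> 0" "f \<ge> 0"
    and A: "A = c*d*(b+e)*(a+f) + b*e*(c+d)*(a+f) + a*f*(c+d)*(b+e)"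
    and C: "C = c*d*(a+b+e+f) + a*f*(b+c+d+e) + b*e*(a+c+d+f)
                + a*b*d + a*c*e + b*c*f + d*e*f"
    and C_nz: "C \<noteq> 0"
  shows "15/32 * (a+b+c+d+e+f) - (7*(a*b*e*f + a*c*d*f + b*c*d*e) + 2*A) / C \<ge> 0
    \<and> (a = b \<and> b = c \<and> c = d \<and> d = e \<and> e = f \<and> f > 0
        \<longrightarrow> 15/32 * (a+b+c+d+e+f) - (7*(a*b*e*f + a*c*d*f + b*c*d*e) + 2*A) / C = 0)"
proof -
  obtain p x where px: "p \<ge> 0" "x^2 \<le> 1" "a = p*(1+x)" "f = p*(1-x)"
    using mean_deviation nonneg by metis
  obtain q y where qy: "q \<ge> 0" "y^2 \<le> 1" "b = q*(1+y)" "e = q*(1-y)"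
    using mean_deviation nonneg by metis
  obtain r z where rz: "r \<ge> 0" "z^2 \<le> 1" "c = r*(1+z)" "d = r*(1-z)"
    using mean_deviation nonneg by metis
  have "C \<ge> 0"
    unfolding C using nonneg by (intro add_nonneg_nonneg mult_nonneg_nonneg)
  then have C_pos: "C > 0" using C_nz by simp
  have "15*(a+b+c+d+e+f)*C - 32*(7*(a*b*e*f + a*c*d*f + b*c*d*e) + 2*A) \<ge> 0"
    unfolding A C by (rule quartic_nonneg_mean_deviation[of p q r x y z]) (fact px qy rz)+
  then have ineq: "15/32 * (a+b+c+d+e+f) - (7*(a*b*e*f + a*c*d*f + b*c*d*e) + 2*A) / C \<ge> 0"
    using C_pos by (simp add: field_simps)
  have "15/32 * (a+b+c+d+e+f) - (7*(a*b*e*f + a*c*d*f + b*c*d*e) + 2*A) / C = 0"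
    if "a = b \<and> b = c \<and> c = d \<and> d = e \<and> e = f \<and> f > 0"
  proof -
    have "A = 12*f^4" "C = 16*f^3" "a*b*e*f + a*c*d*f + b*c*d*e = 3*f^4"
      unfolding A C using that by (auto simp: eval_nat_numeral algebra_simps)
    then show ?thesis
      using that by (simp add: eval_nat_numeral field_simps)
  qed
  with ineq show ?thesis by blast
qed

end
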